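(* Let $A \in \mathbb{C}^{m \times n}$, $W \in \mathbb{C}^{n \times m}$ be such that $k= \mathrm{ind}(A,W)$ and $r(WAW)=r(A)$. Then $X\in \mathbb{C}^{m \times n}$ satisfies $$XWAWX=X, \quad WAWX=P_{\mathcal{R}(WA)}, \quad XW(AW)^k=A^{D,W}W(AW)^k$$ if and only if $X \in A\{1',2',3',{1^{k}}'\}$.
   Context: $r(\cdot)$ and $\mathcal{R}(\cdot)$ denote rank and range; $*$ is conjugate transpose; $P_{\mathcal{S}}$ is the orthogonal projector onto the subspace $\mathcal{S}$. The index $\mathrm{ind}(M)$ of a square matrix $M$ is the smallest non-negative integer $j$ with $r(M^j)=r(M^{j+1})$ (with $M^0=I$); $\mathrm{ind}(A,W)=\max\{\mathrm{ind}(AW),\mathrm{ind}(WA)\}$. $A\{1',2',3',{1^k}'\}$ is the set of all $X\in\mathbb{C}^{m\times n}$ with $AWXWA=A$, $XWAWX=X$, $(WAWX)^*=WAWX$ and $XW(AW)^{k+1}=(AW)^k$. The $W$-weighted Drazin inverse $A^{D,W}\in\mathbb{C}^{m\times n}$ is the unique $X$ satisfying $XW(AW)^{k+1}=(AW)^k$, $XWAWX=X$, $AWX=XWA$ with $k=\mathrm{ind}(A,W)$. *)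

theory Defs
  imports "HOL-Analysis.Analysis"
begin

text \<open>
  An m by n complex matrix is an element of \<^typ>\<open>complex^'n^'m\<close>. The library's \<^const>\<open>rank\<close>
  is, over any field, the dimension (over that field) of the row space.
\<close>

text \<open>The library power \<open>M ^ j\<close> on this type is componentwise, hence a separate matrix power.\<close>

primrec mat_pow :: "complex^'n^'n \<Rightarrow> nat \<Rightarrow> complex^'n^'n" where
  "mat_pow M 0 = mat 1"
| "mat_pow M (Suc j) = M ** mat_pow M j"

definition conj_transpose :: "complex^'n^'m \<Rightarrow> complex^'m^'n" where
  "conj_transpose M = map_matrix cnj (transpose M)"

definition mat_range :: "complex^'n^'m \<Rightarrow> (complex^'m) set" where
  "mat_range M = range (\<lambda>v. M *v v)"

text \<open>Meaningful only if \<open>S\<close> is a complex subspace (\<open>vec.subspace S\<close>).\<close>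

definition orth_projector :: "(complex^'n) set \<Rightarrow> complex^'n^'n" where
  "orth_projector S = (THE P. P ** P = P \<and> conj_transpose P = P \<and> mat_range P = S)"

definition mat_index :: "complex^'n^'n \<Rightarrow> nat" where
  "mat_index M = (LEAST j. rank (mat_pow M j) = rank (mat_pow M (j + 1)))"

definition weighted_index :: "complex^'n^'m \<Rightarrow> complex^'m^'n \<Rightarrow> nat" where
  "weighted_index A W = max (mat_index (A ** W)) (mat_index (W ** A))"

definition weighted_drazin :: "complex^'n^'m \<Rightarrow> complex^'m^'n \<Rightarrow> complex^'n^'m" where
  "weighted_drazin A W =
     (let k = weighted_index A W in
      THE X. X ** W ** mat_pow (A ** W) (k + 1) = mat_pow (A ** W) k
           \<and> X ** W ** A ** W ** X = X
           \<and> A ** W ** X = X ** W ** A)"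

text \<open>The set $A\{1',2',3',{1^k}'\}$ of weighted generalized inverses, with the weight \<open>W\<close> explicit.\<close>

definition weighted_ginverses ::
    "complex^'n^'m \<Rightarrow> complex^'m^'n \<Rightarrow> nat \<Rightarrow> (complex^'n^'m) set" where
  "weighted_ginverses A W k =
     {X. A ** W ** X ** W ** A = A
       \<and> X ** W ** A ** W ** X = X
       \<and> conj_transpose (W ** A ** W ** X) = W ** A ** W ** X
       \<and> X ** W ** mat_pow (A ** W) (k + 1) = mat_pow (A ** W) k}"

end

theory Submission
  imports Defs
begin

text \<open>
  For \<open>M = AW\<close> the matrix \<open>Y = A\<^sup>D\<^sup>,\<^sup>W\<close> satisfies \<open>YW = M\<^sup>D\<close>, so that
  \<open>M\<^sup>k = M\<^sup>k\<^sup>+\<^sup>1 YW\<close> and \<open>YW M\<^sup>k\<^sup>+\<^sup>1 = M\<^sup>k\<close>; these convert \<open>XW M\<^sup>k = YW M\<^sup>k\<close> and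
  \<open>XW M\<^sup>k\<^sup>+\<^sup>1 = M\<^sup>k\<close> into each other. The projector equation says that \<open>WAWX\<close> is Hermitian
  and fixes \<open>WA\<close>, and the rank hypothesis allows cancelling the left factor \<open>W\<close> from
  \<open>W(AWXWA) = WA\<close>.
\<close>

section \<open>Ranks and factorizations\<close>

text \<open>A linear right inverse of \<open>C\<close> on the range of \<open>C\<close>, written as
  a matrix, is an inner inverse.\<close>

lemma inner_inverse_exists:
  fixes C :: "'a::field^'n^'m"
  shows "\<exists>G. C ** G ** C = C"
proof -
  obtain g where g: "Vector_Spaces.linear (*s) (*s) g" "\<forall>v\<in>range ((*v) C). C *v g v = v"
    using vec.linear_exists_right_inverse_on[OF matrix_vector_mul_linear_gen[of C] vec.subspace_UNIV]
    by blast
  then have "C ** matrix g ** C = C"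
    by (simp add: matrix_eq matrix_vector_mul_assoc [symmetric] matrix_works)
  then show ?thesis ..
qed

lemma range_matrix_mult_subset: "range ((*v) (A ** B)) \<subseteq> range ((*v) A)"
  for A :: "'a::field^'n^'m" and B :: "'a^'p^'n"
  by (auto simp: matrix_vector_mul_assoc [symmetric])

text \<open>The assumption forces \<open>A ** B\<close> and \<open>A\<close> to have the same range.
  If \<open>G\<close> is an inner inverse of \<open>A ** B\<close>, then \<open>A ** B ** G\<close>
  fixes this range pointwise, so \<open>R = G ** A\<close> works.\<close>

lemma factor_through_product:
  fixes A :: "'a::field^'n^'m" and B :: "'a^'p^'n"
  assumes "vec.dim (range ((*v) A)) \<le> vec.dim (range ((*v) (A ** B)))"
  shows "\<exists>R. A = A ** B ** R"
proof -
  have sub: "vec.subspace (range ((*v) C))" for C :: "'a^'q^'m"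
    by (intro vec.subspace_image vec.subspace_UNIV)
  have eq: "range ((*v) (A ** B)) = range ((*v) A)"
    by (rule vec.subspace_dim_equal[OF sub sub range_matrix_mult_subset assms])
  obtain G where G: "A ** B ** G ** (A ** B) = A ** B"
    using inner_inverse_exists by blast
  have "A ** B ** G *v (A *v v) = A *v v" for v
  proof -
    obtain u where "A *v v = A ** B *v u"
      using eq by blast
    then show ?thesis
      by (simp only: matrix_vector_mul_assoc G)
  qed
  then have "A = A ** B ** (G ** A)"
    by (simp add: matrix_eq matrix_vector_mul_assoc matrix_mul_assoc)
  then show ?thesis ..
qed

lemma columns_eq_image: "columns A = (*v) A ` cart_basis"
  for A :: "'a::field^'n^'m"
proof -
  have "A *v axis i 1 = column i A" for i
    by (simp add: vec_eq_iff matrix_vector_mult_def column_def axis_def if_distrib cong: if_cong)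
  then show ?thesis
    by (auto simp: columns_def cart_basis_def image_iff) metis
qed

text \<open>Since \<open>rank\<close> is the row rank, passing to transposes lets range arguments
  yield rank statements without the equality of row and column rank.\<close>

lemma rank_eq_dim_range_transpose: "rank A = vec.dim (range ((*v) (transpose A)))"
  for A :: "'a::field^'n^'m"
proof -
  have "rank A = vec.dim (vec.span (columns (transpose A)))"
    by (simp add: row_rank_def_gen columns_transpose)
  also have "vec.span (columns (transpose A)) = range ((*v) (transpose A))"
    by (simp only: columns_eq_image vec.span_image span_cart_basis)
  finally show ?thesis .
qed

lemma rank_mult_le_right: "rank (B ** A) \<le> rank A"
  for A :: "'a::field^'n^'m" and B :: "'a^'m^'p"
  unfolding rank_eq_dim_range_transpose matrix_transpose_mul
  by (rule vec.dim_subset[OF range_matrix_mult_subset])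

lemma rank_mult_le_left: "rank (A ** B) \<le> rank A"
  for A :: "'a::field^'n^'m" and B :: "'a^'p^'n"
proof -
  have "range ((*v) (transpose (A ** B))) = (*v) (transpose B) ` range ((*v) (transpose A))"
    by (simp only: matrix_transpose_mul image_image matrix_vector_mul_assoc)
  then show ?thesis
    unfolding rank_eq_dim_range_transpose by (metis vec.dim_image_le matrix_vector_mul_linear_gen)
qed

text \<open>Transposed form of \<open>factor_through_product\<close>: a left factor that does not
  lower the rank can be cancelled.\<close>

lemma factor_of_rank_mult:
  fixes A :: "'a::field^'n^'m" and B :: "'a^'m^'p"
  assumes "rank A \<le> rank (B ** A)"
  shows "\<exists>L. A = L ** B ** A"
proof -
  obtain R where "transpose A = transpose A ** transpose B ** R"
    using factor_through_product[of "transpose A" "transpose B"] assms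
    unfolding rank_eq_dim_range_transpose matrix_transpose_mul by blast
  then have "A = transpose (transpose A ** transpose B ** R)"
    by (metis transpose_transpose)
  also have "\<dots> = transpose R ** B ** A"
    by (simp add: matrix_transpose_mul transpose_transpose matrix_mul_assoc)
  finally show ?thesis ..
qed

section \<open>Orthogonal projectors\<close>

lemma conj_transpose_mult: "conj_transpose (A ** B) = conj_transpose B ** conj_transpose A"
  by (simp add: conj_transpose_def vec_eq_iff matrix_matrix_mult_def transpose_def
      map_matrix_def mult.commute)

lemma conj_transpose_conj_transpose [simp]: "conj_transpose (conj_transpose A) = A"
  by (simp add: conj_transpose_def vec_eq_iff transpose_def map_matrix_def)

text \<open>With \<open>u = B *v v\<close>, the squared norm of \<open>u\<close> equals the inner
  product of \<open>conj_transpose B *v u\<close> with \<open>v\<close>, hence vanishes.\<close>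

lemma conj_transpose_mult_self_eq_0:
  assumes "conj_transpose B *v (B *v v) = 0"
  shows "B *v v = 0"
proof -
  define u where "u = B *v v"
  have "(\<Sum>i\<in>UNIV. cnj (u $ i) * u $ i) = (\<Sum>i\<in>UNIV. \<Sum>j\<in>UNIV. cnj (B $ i $ j) * cnj (v $ j) * u $ i)"
    by (simp add: u_def matrix_vector_mult_def sum_distrib_right)
  also have "\<dots> = (\<Sum>j\<in>UNIV. cnj (v $ j) * (conj_transpose B *v u) $ j)"
    by (subst sum.swap)
      (simp add: matrix_vector_mult_def conj_transpose_def transpose_def map_matrix_def
        sum_distrib_left mult_ac)
  also have "\<dots> = 0"
    using assms by (simp add: u_def)
  finally have "complex_of_real (\<Sum>i\<in>UNIV. (cmod (u $ i))\<^sup>2) = 0"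
    by (simp add: complex_norm_square mult.commute del: of_real_power)
  then have "(\<Sum>i\<in>UNIV. (cmod (u $ i))\<^sup>2) = 0"
    using of_real_eq_0_iff by blast
  then have "u = 0"
    by (simp add: sum_nonneg_eq_0_iff vec_eq_iff)
  then show ?thesis
    by (simp add: u_def)
qed

text \<open>Every \<open>v - G ** C *v v\<close> lies in the kernel of \<open>C\<close>, which is
  the kernel of \<open>B\<close>; hence \<open>Z = B ** G\<close> works.\<close>

lemma factor_conj_transpose_mult_self: "\<exists>Z. B = Z ** conj_transpose B ** B"
proof -
  define C where "C = conj_transpose B ** B"
  obtain G where G: "C ** G ** C = C"
    using inner_inverse_exists by blast
  have "B *v (v - G ** C *v v) = 0" for v
  proof (rule conj_transpose_mult_self_eq_0)
    have "C *v (v - G ** C *v v) = C *v v - C ** G ** C *v v"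
      by (simp add: vec.diff matrix_vector_mul_assoc matrix_mul_assoc)
    then have "C *v (v - G ** C *v v) = 0"
      by (simp add: G)
    then show "conj_transpose B *v (B *v (v - G ** C *v v)) = 0"
      by (simp add: C_def matrix_vector_mul_assoc)
  qed
  then have "B = B ** G ** C"
    by (simp add: matrix_eq vec.diff matrix_vector_mul_assoc matrix_mul_assoc)
  then show ?thesis
    by (auto simp: C_def matrix_mul_assoc)
qed

lemma mat_range_subset_iff:
  assumes "P ** P = P"
  shows "mat_range B \<subseteq> mat_range P \<longleftrightarrow> P ** B = B"
proof
  assume sub: "mat_range B \<subseteq> mat_range P"
  have "P *v (B *v v) = B *v v" for v
  proof -
    obtain u where "B *v v = P *v u"
      using sub by (auto simp: mat_range_def)
    then show ?thesis
      by (simp add: matrix_vector_mul_assoc assms)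
  qed
  then show "P ** B = B"
    by (simp add: matrix_eq matrix_vector_mul_assoc)
next
  assume "P ** B = B"
  then show "mat_range B \<subseteq> mat_range P"
    unfolding mat_range_def by (metis range_matrix_mult_subset)
qed

text \<open>Projectors with a common range fix each other: \<open>P ** Q = Q\<close> and
  \<open>Q ** P = P\<close>. The adjoint of the first equation is \<open>Q ** P = Q\<close>, so
  \<open>Q = P\<close>.\<close>

lemma orth_projector_unique:
  assumes "P ** P = P" "conj_transpose P = P" "mat_range P = S"
  shows "orth_projector S = P"
  unfolding orth_projector_def
proof (rule the_equality)
  fix Q
  assume Q: "Q ** Q = Q \<and> conj_transpose Q = Q \<and> mat_range Q = S"
  have "P ** Q = Q" "Q ** P = P"
    using Q assms mat_range_subset_iff[of P Q] mat_range_subset_iff[of Q P] by auto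
  then show "Q = P"
    by (metis Q assms(2) conj_transpose_mult)
qed (use assms in auto)

lemma orth_projector_mat_range:
  "conj_transpose (orth_projector (mat_range B)) = orth_projector (mat_range B)"
  "orth_projector (mat_range B) ** B = B"
proof -
  obtain Z where Z: "B = Z ** conj_transpose B ** B"
    using factor_conj_transpose_mult_self by blast
  define P where "P = Z ** conj_transpose B"
  have PB: "P ** B = B"
    using Z by (simp add: P_def)
  have P': "conj_transpose P = B ** conj_transpose Z"
    by (simp add: P_def conj_transpose_mult)
  \<comment> \<open>The left side is Hermitian, so this one equation makes \<open>P\<close>
    Hermitian and then idempotent.\<close>
  have "P ** conj_transpose P = conj_transpose P"
    by (simp add: P' matrix_mul_assoc PB)
  then have herm: "conj_transpose P = P"
    by (metis conj_transpose_conj_transpose conj_transpose_mult)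
  then have idem: "P ** P = P"
    using \<open>P ** conj_transpose P = conj_transpose P\<close> by simp
  have "mat_range P = mat_range B"
  proof
    show "mat_range P \<subseteq> mat_range B"
      using P' herm range_matrix_mult_subset unfolding mat_range_def by metis
    show "mat_range B \<subseteq> mat_range P"
      using mat_range_subset_iff[OF idem] PB by blast
  qed
  then have "orth_projector (mat_range B) = P"
    by (rule orth_projector_unique[OF idem herm])
  then show "conj_transpose (orth_projector (mat_range B)) = orth_projector (mat_range B)"
    "orth_projector (mat_range B) ** B = B"
    by (simp_all add: herm PB)
qed

text \<open>The second equation on the right makes \<open>B ** X\<close> an idempotent with the
  range of \<open>B\<close>. This turns the projector condition into two of the defining equations
  of the weighted inverses.\<close>

lemma eq_orth_projector_iff:
  "B ** X = orth_projector (mat_range B) \<longleftrightarrow>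
    conj_transpose (B ** X) = B ** X \<and> B ** X ** B = B"
proof
  assume "B ** X = orth_projector (mat_range B)"
  then show "conj_transpose (B ** X) = B ** X \<and> B ** X ** B = B"
    using orth_projector_mat_range[of B] by simp
next
  assume R: "conj_transpose (B ** X) = B ** X \<and> B ** X ** B = B"
  have idem: "B ** X ** (B ** X) = B ** X"
    by (simp add: matrix_mul_assoc R)
  have "mat_range (B ** X) = mat_range B"
    using mat_range_subset_iff[OF idem, of B] R range_matrix_mult_subset[of B X]
    by (auto simp: mat_range_def)
  then show "B ** X = orth_projector (mat_range B)"
    using orth_projector_unique[OF idem] R by simp
qed

section \<open>Powers and the index\<close>

lemma mat_pow_add: "mat_pow M (i + j) = mat_pow M i ** mat_pow M j"
  by (induction i) (simp_all add: matrix_mul_assoc)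

lemma mat_pow_swap: "mat_pow (A ** B) j ** A = A ** mat_pow (B ** A) j"
  by (induction j) (simp_all, metis matrix_mul_assoc)

lemma mat_pow_commute: "M ** mat_pow M j = mat_pow M j ** M"
  using mat_pow_swap[of M "mat 1" j] by simp

lemma mat_pow_factor:
  assumes "mat_index M \<le> k"
  shows "\<exists>L. mat_pow M k = L ** mat_pow M (Suc k)"
proof -
  let ?r = "\<lambda>j. rank (mat_pow M j)"
  \<comment> \<open>The \<open>LEAST\<close> in \<open>mat_index\<close> is attained because ranks
    of successive powers cannot decrease strictly forever.\<close>
  have "\<exists>j. ?r j = ?r (j + 1)"
  proof (rule ccontr)
    assume "\<nexists>j. ?r j = ?r (j + 1)"
    then have less: "?r (Suc j) < ?r j" for j
      using rank_mult_le_right[of M "mat_pow M j"] by (metis Suc_eq_plus1 le_neq_implies_less mat_pow.simps(2))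
    have "?r j + j \<le> ?r 0" for j
    proof (induction j)
      case (Suc j)
      then show ?case using less[of j] by linarith
    qed simp
    from this[of "Suc (?r 0)"] show False by simp
  qed
  then have "?r (mat_index M) = ?r (mat_index M + 1)"
    unfolding mat_index_def by (rule LeastI_ex)
  then obtain L where L: "mat_pow M (mat_index M) = L ** M ** mat_pow M (mat_index M)"
    using factor_of_rank_mult[of "mat_pow M (mat_index M)" M] by auto
  obtain i where "k = mat_index M + i"
    using assms le_Suc_ex by blast
  then have "mat_pow M k = L ** mat_pow M (Suc k)"
    by (simp add: mat_pow_add matrix_mul_assoc L [symmetric])
  then show ?thesis ..
qed

section \<open>Drazin inverses\<close>

text \<open>The exponent is a parameter because the maximum of the two indices may exceed the index
  of \<open>A ** W\<close>.\<close>

definition is_drazin :: "complex^'n^'n \<Rightarrow> nat \<Rightarrow> complex^'n^'n \<Rightarrow> bool" where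
  "is_drazin M k D \<longleftrightarrow> D ** mat_pow M (k + 1) = mat_pow M k \<and> D ** M ** D = D \<and> M ** D = D ** M"

lemma drazin_exists:
  assumes "mat_index M \<le> k"
  shows "\<exists>D. is_drazin M k D"
proof -
  txt \<open>With \<open>Q = M\<^sup>k\<close> and factorizations \<open>Q = L QMQ = QMQ R\<close>, the matrix \<open>LQ = QR\<close> is the inverse.\<close>
  define Q where "Q = mat_pow M k"
  obtain Z where Z: "Q = Z ** M ** Q"
    using mat_pow_factor[OF assms] by (auto simp: Q_def matrix_mul_assoc)
  have comm: "M ** Q = Q ** M"
    by (simp add: Q_def mat_pow_commute)
  \<comment> \<open>Iterating \<open>Q = Z ** M ** Q\<close> splits off any power;
    \<open>i = Suc k\<close> gives \<open>Q = L ** Q ** M ** Q\<close>.\<close>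
  have "\<exists>L. Q = L ** mat_pow M i ** Q" for i
  proof (induction i)
    case 0
    show ?case by (metis mat_pow.simps(1) matrix_mul_lid)
  next
    case (Suc i)
    then obtain L where "Q = L ** mat_pow M i ** Q" ..
    also have "\<dots> = L ** Q ** mat_pow M i"
      by (metis Q_def add.commute mat_pow_add matrix_mul_assoc)
    also have "\<dots> = L ** Z ** M ** Q ** mat_pow M i"
      by (metis Z matrix_mul_assoc)
    also have "\<dots> = L ** Z ** mat_pow M (Suc i) ** Q"
      by (metis Q_def add.commute mat_pow.simps(2) mat_pow_add matrix_mul_assoc)
    finally show ?case by blast
  qed
  then obtain L where "Q = L ** mat_pow M (Suc k) ** Q"
    by blast
  then have L: "Q = L ** Q ** M ** Q"
    by (simp add: Q_def [symmetric] comm matrix_mul_assoc)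
  \<comment> \<open>The left factorization shows that \<open>Q ** M ** Q\<close> has at least the
    range dimension of \<open>Q\<close>, which yields the right factorization.\<close>
  have "vec.dim (range ((*v) Q)) \<le> vec.dim (range ((*v) (Q ** (M ** Q))))"
  proof -
    have "range ((*v) Q) = (*v) L ` range ((*v) (Q ** (M ** Q)))"
      by (subst L) (simp add: image_image matrix_vector_mul_assoc matrix_mul_assoc)
    then show ?thesis
      by (metis vec.dim_image_le matrix_vector_mul_linear_gen)
  qed
  then obtain R where R: "Q = Q ** M ** Q ** R"
    using factor_through_product by (metis matrix_mul_assoc)
  have D: "L ** Q = Q ** R"
    by (metis L R matrix_mul_assoc)
  have "L ** Q ** M = L ** Q ** M ** Q ** M ** R"
    by (metis R comm matrix_mul_assoc)
  also have "\<dots> = M ** Q ** R"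
    by (metis L comm)
  finally have MD: "M ** (L ** Q) = L ** Q ** M"
    by (simp add: D matrix_mul_assoc)
  have "L ** Q ** M ** (L ** Q) = L ** Q"
    by (simp add: D matrix_mul_assoc) (metis D L matrix_mul_assoc)
  moreover have "L ** Q ** mat_pow M (k + 1) = mat_pow M k"
    using L by (simp add: Q_def [symmetric] matrix_mul_assoc)
  ultimately show ?thesis
    using MD unfolding is_drazin_def by blast
qed

lemma drazin_mat_pow_right:
  assumes "is_drazin M k D"
  shows "mat_pow M (Suc k) ** D = mat_pow M k"
proof -
  have "mat_pow M j ** D = D ** mat_pow M j" for j
    using assms unfolding is_drazin_def
    by (induction j) (simp_all, metis matrix_mul_assoc)
  then have "mat_pow M (Suc k) ** D = D ** mat_pow M (Suc k)" .
  then show ?thesis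
    using assms by (simp add: is_drazin_def)
qed

text \<open>A Drazin inverse \<open>F\<close> satisfies
  \<open>F = F ** F ** M = M ** F ** F\<close>, so every power of \<open>M\<close> splits off on
  either side. With the power \<open>k\<close>, \<open>D ** M ** E\<close> collapses both to
  \<open>D\<close> and to \<open>E\<close>.\<close>

lemma drazin_unique:
  assumes "is_drazin M k D" "is_drazin M k E"
  shows "D = E"
proof -
  have left: "\<exists>U. F = U ** mat_pow M j" if "is_drazin M k F" for F j
  proof (induction j)
    case 0
    show ?case by (metis mat_pow.simps(1) matrix_mul_rid)
  next
    case (Suc j)
    then obtain U where U: "F = U ** mat_pow M j" ..
    have "F = F ** F ** M"
      using that unfolding is_drazin_def by (metis matrix_mul_assoc)
    also have "\<dots> = F ** U ** mat_pow M (Suc j)"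
      by (metis U mat_pow.simps(2) mat_pow_commute matrix_mul_assoc)
    finally show ?case by blast
  qed
  have right: "\<exists>U. F = mat_pow M j ** U" if "is_drazin M k F" for F j
  proof (induction j)
    case 0
    show ?case by (metis mat_pow.simps(1) matrix_mul_lid)
  next
    case (Suc j)
    then obtain U where U: "F = mat_pow M j ** U" ..
    have "F = M ** F ** F"
      using that unfolding is_drazin_def by (metis matrix_mul_assoc)
    also have "\<dots> = mat_pow M (Suc j) ** (U ** F)"
      by (metis U mat_pow.simps(2) matrix_mul_assoc)
    finally show ?case by blast
  qed
  obtain U where "D = U ** mat_pow M k"
    using left assms(1) by blast
  then have "D ** M ** E = D"
    using drazin_mat_pow_right[OF assms(2)] mat_pow_commute[of M k]
    by (metis mat_pow.simps(2) matrix_mul_assoc)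
  moreover obtain V where "E = mat_pow M k ** V"
    using right assms(2) by blast
  then have "D ** M ** E = E"
    using assms(1) unfolding is_drazin_def
    by (metis Suc_eq_plus1 mat_pow.simps(2) matrix_mul_assoc)
  ultimately show ?thesis by simp
qed

section \<open>Weighted Drazin inverses\<close>

definition is_weighted_drazin ::
    "complex^'n^'m \<Rightarrow> complex^'m^'n \<Rightarrow> nat \<Rightarrow> complex^'n^'m \<Rightarrow> bool" where
  "is_weighted_drazin A W k Y \<longleftrightarrow>
     Y ** W ** mat_pow (A ** W) (k + 1) = mat_pow (A ** W) k
     \<and> Y ** W ** A ** W ** Y = Y \<and> A ** W ** Y = Y ** W ** A"

lemma is_weighted_drazin_imp_drazin:
  assumes "is_weighted_drazin A W k Y"
  shows "is_drazin (A ** W) k (Y ** W)"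
  using assms unfolding is_weighted_drazin_def is_drazin_def by (metis matrix_mul_assoc)

text \<open>\<open>F\<close> is recovered from \<open>F ** W\<close>, a Drazin inverse of
  \<open>A ** W\<close>, by \<open>F = F ** W ** (F ** W) ** A\<close>.\<close>

lemma weighted_drazin_unique:
  assumes "is_weighted_drazin A W k Y" "is_weighted_drazin A W k Z"
  shows "Y = Z"
proof -
  have *: "F = F ** W ** (F ** W) ** A" if "is_weighted_drazin A W k F" for F
    using that unfolding is_weighted_drazin_def by (metis matrix_mul_assoc)
  have "Y ** W = Z ** W"
    using assms by (blast intro: drazin_unique is_weighted_drazin_imp_drazin)
  then show ?thesis
    using *[OF assms(1)] *[OF assms(2)] by simp
qed

lemma weighted_drazin_exists:
  assumes "mat_index (A ** W) \<le> k" "mat_index (W ** A) \<le> k"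
  shows "\<exists>Y. is_weighted_drazin A W k Y"
proof -
  let ?M = "A ** W" and ?N = "W ** A"
  obtain D where D: "is_drazin ?M k D"
    using drazin_exists assms(1) by blast
  obtain E where E: "is_drazin ?N k E"
    using drazin_exists assms(2) by blast
  have E1: "E ** mat_pow ?N (Suc k) = mat_pow ?N k" and E2: "E ** ?N ** E = E"
    and E3: "?N ** E = E ** ?N"
    using E by (auto simp: is_drazin_def)
  \<comment> \<open>This is the classical formula: \<open>A\<close> times the square of the Drazin
    inverse of \<open>W ** A\<close>.\<close>
  define Y where "Y = A ** E ** E"
  txt \<open>Passing from \<open>AW\<close> to \<open>WA\<close> costs one power, which is removed afterwards by means of \<open>D\<close>.\<close>
  have "Y ** W ** mat_pow ?M (Suc (Suc k)) = A ** E ** E ** (mat_pow ?N (Suc (Suc k)) ** W)"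
    by (metis Y_def mat_pow_swap matrix_mul_assoc)
  also have "\<dots> = A ** E ** (E ** mat_pow ?N (Suc k)) ** ?N ** W"
    by (metis mat_pow.simps(2) mat_pow_commute matrix_mul_assoc)
  also have "\<dots> = A ** E ** (mat_pow ?N k ** ?N) ** W"
    by (simp only: E1 matrix_mul_assoc)
  also have "\<dots> = A ** (E ** mat_pow ?N (Suc k)) ** W"
    by (metis mat_pow.simps(2) mat_pow_commute matrix_mul_assoc)
  also have "\<dots> = mat_pow ?M k ** A ** W"
    by (simp only: E1 mat_pow_swap)
  also have "\<dots> = mat_pow ?M (Suc k)"
    by (metis mat_pow.simps(2) mat_pow_commute matrix_mul_assoc)
  finally have step: "Y ** W ** mat_pow ?M (Suc (Suc k)) = mat_pow ?M (Suc k)" .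
  have D': "mat_pow ?M (Suc (Suc k)) ** D = mat_pow ?M (Suc k)"
    using drazin_mat_pow_right[OF D] by (metis mat_pow.simps(2) matrix_mul_assoc)
  have "Y ** W ** mat_pow ?M (Suc k) = Y ** W ** mat_pow ?M (Suc (Suc k)) ** D"
    by (simp only: D' matrix_mul_assoc [symmetric])
  also have "\<dots> = mat_pow ?M k"
    by (simp only: step drazin_mat_pow_right[OF D])
  finally have pow: "Y ** W ** mat_pow ?M (Suc k) = mat_pow ?M k" .
  have "A ** W ** Y = A ** (?N ** E) ** E"
    by (simp only: Y_def matrix_mul_assoc)
  also have "\<dots> = A ** (E ** ?N ** E)"
    by (simp only: E3 matrix_mul_assoc)
  finally have AWY: "A ** W ** Y = A ** E"
    by (simp only: E2)
  have "Y ** W ** A = A ** E ** (E ** ?N)"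
    by (simp only: Y_def matrix_mul_assoc)
  also have "\<dots> = A ** E ** (?N ** E)"
    by (simp only: E3)
  also have "\<dots> = A ** (E ** ?N ** E)"
    by (simp only: matrix_mul_assoc)
  finally have YWA: "Y ** W ** A = A ** E"
    by (simp only: E2)
  have "Y ** W ** A ** W ** Y = A ** E ** W ** Y"
    by (simp only: YWA)
  also have "\<dots> = A ** (E ** ?N ** E) ** E"
    by (simp only: Y_def matrix_mul_assoc)
  also have "\<dots> = Y"
    by (simp only: E2 Y_def)
  finally have "Y ** W ** A ** W ** Y = Y" .
  then show ?thesis
    unfolding is_weighted_drazin_def using pow AWY YWA by auto
qed

lemma is_weighted_drazin_weighted_drazin:
  "is_weighted_drazin A W (weighted_index A W) (weighted_drazin A W)"
proof -
  have "\<exists>!Y. is_weighted_drazin A W (weighted_index A W) Y"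
    using weighted_drazin_exists[of A W "weighted_index A W"] weighted_drazin_unique
    by (fastforce simp: weighted_index_def)
  then show ?thesis
    using theI'[of "is_weighted_drazin A W (weighted_index A W)"]
    by (simp add: weighted_drazin_def is_weighted_drazin_def Let_def)
qed

text \<open>Multiply on the right by \<open>M\<close> in one direction and by \<open>D\<close>,
  which commutes with \<open>M\<close>, in the other.\<close>

lemma drazin_mat_pow_eq_iff:
  assumes "is_drazin M k D"
  shows "T ** mat_pow M k = D ** mat_pow M k \<longleftrightarrow> T ** mat_pow M (k + 1) = mat_pow M k"
proof
  assume "T ** mat_pow M k = D ** mat_pow M k"
  then show "T ** mat_pow M (k + 1) = mat_pow M k"
    using assms mat_pow_commute[of M k] unfolding is_drazin_def
    by (metis Suc_eq_plus1 mat_pow.simps(2) matrix_mul_assoc)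
next
  assume "T ** mat_pow M (k + 1) = mat_pow M k"
  then show "T ** mat_pow M k = D ** mat_pow M k"
    using drazin_mat_pow_right[OF assms] assms unfolding is_drazin_def
    by (metis Suc_eq_plus1 matrix_mul_assoc)
qed

theorem theorem4p8:
  fixes A :: "complex^'n^'m" and W :: "complex^'m^'n" and X :: "complex^'n^'m" and k :: nat
  assumes "k = weighted_index A W"
    and "rank (W ** A ** W) = rank A"
  shows "(X ** W ** A ** W ** X = X
          \<and> W ** A ** W ** X = orth_projector (mat_range (W ** A))
          \<and> X ** W ** mat_pow (A ** W) k = weighted_drazin A W ** W ** mat_pow (A ** W) k)
     \<longleftrightarrow> X \<in> weighted_ginverses A W k"
proof -
  define Y where "Y = weighted_drazin A W"
  have drazin: "is_drazin (A ** W) k (Y ** W)"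
    using is_weighted_drazin_weighted_drazin[of A W] assms(1)
    by (simp add: Y_def is_weighted_drazin_imp_drazin)
  have "rank A \<le> rank (W ** A)"
    using assms(2) rank_mult_le_left[of "W ** A" W] by simp
  then obtain L where L: "A = L ** W ** A"
    using factor_of_rank_mult by blast
  \<comment> \<open>Left multiplication by \<open>L\<close> removes the leading \<open>W\<close>;
    the converse multiplies by \<open>W\<close>.\<close>
  have cancel: "W ** A ** W ** X ** (W ** A) = W ** A \<longleftrightarrow> A ** W ** X ** W ** A = A"
    using L by (metis matrix_mul_assoc)
  have "W ** A ** W ** X = orth_projector (mat_range (W ** A)) \<longleftrightarrow>
      conj_transpose (W ** A ** W ** X) = W ** A ** W ** X \<and> A ** W ** X ** W ** A = A"
    using eq_orth_projector_iff[of "W ** A" "W ** X"] cancel by (simp add: matrix_mul_assoc)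
  then show ?thesis
    using drazin_mat_pow_eq_iff[OF drazin, of "X ** W"]
    unfolding weighted_ginverses_def Y_def by auto
qed

end
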